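(* Any algorithm that PAC learns all monotone submodular functions with range $[0,1]$ over the uniform distribution to $\ell_2$ error $\epsilon>0$ requires $2^{\Omega(\epsilon^{-4/5})}$ random examples of (or value queries to) the target function.
   Context: $f:\{0,1\}^n\to\mathbb{R}$ (identified with a set function on $[n]$) is monotone if $f(A)\le f(B)$ whenever $A\subseteq B$, and submodular if $f(A\cup B)+f(A\cap B)\le f(A)+f(B)$ for all $A,B$. An algorithm PAC learns a class $\mathcal{F}$ with $\ell_2$ error $\epsilon$ over the uniform distribution if for every target $f\in\mathcal{F}$, given independent examples $(x,f(x))$ with $x$ uniform on $\{0,1\}^n$, with probability at least $2/3$ it outputs $h$ with $\|f-h\|_2=\sqrt{\mathbb{E}_x[(f(x)-h(x))^2]}\le\epsilon$. A value query returns $f(x)$ for a point $x$ chosen by the algorithm. *)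

theory Defs
  imports "HOL-Probability.Probability"
begin

text \<open>
  Points of \<open>{0,1}\<^sup>n\<close> are subsets of \<open>{1..n}\<close>. Membership in \<open>\<rightarrow>\<^sub>E\<close> makes a target \<open>undefined\<close>
  outside the cube, so evaluating it there reveals nothing about it.
\<close>

definition cube :: "nat \<Rightarrow> nat set set" where
  "cube n = Pow {1..n}"

definition submodular_on :: "'a set set \<Rightarrow> ('a set \<Rightarrow> real) \<Rightarrow> bool" where
  "submodular_on X f \<longleftrightarrow> (\<forall>A\<in>X. \<forall>B\<in>X. f (A \<union> B) + f (A \<inter> B) \<le> f A + f B)"

definition monotone_submodular_functions :: "nat \<Rightarrow> (nat set \<Rightarrow> real) set" where
  "monotone_submodular_functions n =
     {f \<in> cube n \<rightarrow>\<^sub>E {0..1}. mono_on (cube n) f \<and> submodular_on (cube n) f}"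

definition l2_dist :: "'x pmf \<Rightarrow> ('x \<Rightarrow> real) \<Rightarrow> ('x \<Rightarrow> real) \<Rightarrow> real" where
  "l2_dist D f h = sqrt (measure_pmf.expectation D (\<lambda>x. (f x - h x)\<^sup>2))"

text \<open>
  A learning algorithm is an adaptive strategy without computational restrictions: it may
  randomize internally (\<open>Randomize\<close>), request a labelled random example, or ask for the value of
  the target at a point of its choice, and each continuation may depend on everything seen so far.
  An algorithm that only has access to random examples is one without \<open>Value_Query\<close> nodes, and an
  algorithm that only has access to value queries is one without \<open>Random_Example\<close> nodes.
\<close>

datatype 'x learner =
    Output "'x \<Rightarrow> real"
  | Randomize "'x learner pmf"
  | Random_Example "'x \<Rightarrow> real \<Rightarrow> 'x learner"
  | Value_Query 'x "real \<Rightarrow> 'x learner"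

text \<open>
  The joint distribution of the output hypothesis and the total number of random examples and value
  queries used; each random example is a fresh draw from \<open>D\<close>.
\<close>

primrec run :: "'x pmf \<Rightarrow> ('x \<Rightarrow> real) \<Rightarrow> 'x learner \<Rightarrow> (('x \<Rightarrow> real) \<times> nat) pmf" where
  "run D f (Output h) = return_pmf (h, 0)"
| "run D f (Randomize p) = join_pmf (map_pmf (run D f) p)"
| "run D f (Random_Example k) =
     bind_pmf D (\<lambda>x. map_pmf (apsnd Suc) (run D f (k x (f x))))"
| "run D f (Value_Query x k) = map_pmf (apsnd Suc) (run D f (k (f x)))"

definition pac_learns ::
  "'x pmf \<Rightarrow> ('x \<Rightarrow> real) set \<Rightarrow> real \<Rightarrow> 'x learner \<Rightarrow> bool" where
  "pac_learns D F \<epsilon> L \<longleftrightarrow>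
     (\<forall>f\<in>F. measure_pmf.prob (run D f L) {(h, m). l2_dist D f h \<le> \<epsilon>} \<ge> 2/3)"

definition uses_at_most ::
  "'x pmf \<Rightarrow> ('x \<Rightarrow> real) set \<Rightarrow> nat \<Rightarrow> 'x learner \<Rightarrow> bool" where
  "uses_at_most D F q L \<longleftrightarrow> (\<forall>f\<in>F. \<forall>(h, m)\<in>set_pmf (run D f L). m \<le> q)"

end

theory Submission imports Defs begin

text \<open>
  The function \<open>min |A| m / m\<close> on the subsets of \<open>{1..2m}\<close> has curvature \<open>1/m\<close> at the middle layer,
  so it stays monotone and submodular when its value is lowered by \<open>1/(2m)\<close> at an arbitrary set \<open>S\<close> of
  middle points. An example or query reveals at most one bit of \<open>S\<close>. With fewer than half of the
  middle points seen, flipping all unseen bits of \<open>S\<close> yields an equally likely target at squared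
  distance of order \<open>m\<^sup>-\<^sup>2 \<cdot> m\<^sup>-\<^sup>1\<^sup>/\<^sup>2\<close>, because the middle layer has density of order \<open>m\<^sup>-\<^sup>1\<^sup>/\<^sup>2\<close>.
  So for \<open>m\<close> a small multiple of \<open>\<epsilon>\<^sup>-\<^sup>4\<^sup>/\<^sup>5\<close> no output is \<open>\<epsilon>\<close>-close to both, and the
  success probability for a random \<open>S\<close> is at most 1/2.
\<close>

section \<open>Averaging success probabilities over a hidden set of bits\<close>

lemma prob_bind_pmf:
  "measure_pmf.prob (bind_pmf D R) X = measure_pmf.expectation D (\<lambda>x. measure_pmf.prob (R x) X)"
  unfolding measure_pmf_bind
  by (rule measure_pmf.measure_bind[where N = "count_space UNIV"])
     (auto simp: space_subprob_algebra measure_pmf.subprob_space_axioms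
        intro!: measurable_pmf_measure1)

text \<open>The draw from \<open>D\<close> is the same for every index \<open>i\<close>, so sum and
  expectation can be swapped and each outcome treated separately. This disposes of internal
  randomness and of random examples.\<close>

lemma sum_prob_bind_pmf_le:
  assumes "\<And>x. x \<in> set_pmf D \<Longrightarrow> (\<Sum>i\<in>I. measure_pmf.prob (R i x) (X i)) \<le> c"
  shows "(\<Sum>i\<in>I. measure_pmf.prob (bind_pmf D (R i)) (X i)) \<le> c"
proof -
  have int: "integrable (measure_pmf D) (\<lambda>x. measure_pmf.prob (R i x) (X i))" for i
    by (rule measure_pmf.integrable_const_bound[where B = 1]) auto
  have "(\<Sum>i\<in>I. measure_pmf.prob (bind_pmf D (R i)) (X i)) =
      measure_pmf.expectation D (\<lambda>x. \<Sum>i\<in>I. measure_pmf.prob (R i x) (X i))"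
    by (simp add: prob_bind_pmf int)
  also have "\<dots> \<le> measure_pmf.expectation D (\<lambda>x. c)"
    by (intro integral_mono_AE Bochner_Integration.integrable_sum int)
       (auto simp: AE_measure_pmf_iff assms)
  also have "\<dots> = c"
    by simp
  finally show ?thesis .
qed

lemma sum_Pow_split:
  fixes f :: "'a set \<Rightarrow> 'b::comm_monoid_add"
  assumes "finite U" "z \<in> U"
  shows "sum f (Pow U) = sum f (Pow (U - {z})) + (\<Sum>S\<in>Pow (U - {z}). f (insert z S))"
proof -
  have "sum f (Pow U) = sum f (Pow (U - {z}) \<union> insert z ` Pow (U - {z}))"
    using Pow_insert[of z "U - {z}"] assms by (simp add: insert_absorb)
  also have "\<dots> = sum f (Pow (U - {z})) + sum f (insert z ` Pow (U - {z}))"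
    using assms by (intro sum.union_disjoint) auto
  also have "sum f (insert z ` Pow (U - {z})) = (\<Sum>S\<in>Pow (U - {z}). f (insert z S))"
    by (subst sum.reindex) (auto simp: inj_on_def)
  finally show ?thesis .
qed

text \<open>
  \<open>T\<close> holds the bits already revealed as true and \<open>U\<close> the positions not looked at yet. At the leaves
  every output is good for at most one of the two completions \<open>T \<union> S\<close> and \<open>T \<union> (U - S)\<close>.
\<close>

lemma sum_success_le:
  fixes D :: "'x pmf" and g :: "'x \<Rightarrow> bool \<Rightarrow> real" and p :: "'x \<Rightarrow> 'p"
    and good :: "'p set \<Rightarrow> ('x \<Rightarrow> real) set"
  defines "F \<equiv> \<lambda>S x. g x (p x \<in> S)"
  assumes sep: "\<And>S S'. S \<subseteq> M \<Longrightarrow> S' \<subseteq> M \<Longrightarrow> N \<le> card (sym_diff S S') \<Longrightarrow> good S \<inter> good S' = {}"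
    and M: "finite M"
    and "T \<union> U \<subseteq> M" "T \<inter> U = {}" "N + q \<le> card U"
  shows "(\<Sum>S\<in>Pow U. measure_pmf.prob (run D (F (T \<union> S)) L) {(h, m). h \<in> good (T \<union> S) \<and> m \<le> q})
    \<le> 2 ^ card U / 2"
proof -
  \<comment> \<open>Once drawn, a random example is a query at a fixed \<open>x\<close>, so one
    argument serves both constructors; the induction hypothesis enters as the premise
    \<open>IH\<close>.\<close>
  have query: "(\<Sum>S\<in>Pow U. measure_pmf.prob
        (map_pmf (apsnd Suc) (run D (F (T \<union> S)) (k (F (T \<union> S) x))))
        {(h, m). h \<in> good (T \<union> S) \<and> m \<le> q}) \<le> 2 ^ card U / 2"
    if IH: "\<And>r T U q. \<lbrakk>T \<union> U \<subseteq> M; T \<inter> U = {}; N + q \<le> card U\<rbrakk> \<Longrightarrow>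
        (\<Sum>S\<in>Pow U. measure_pmf.prob (run D (F (T \<union> S)) (k r))
          {(h, m). h \<in> good (T \<union> S) \<and> m \<le> q}) \<le> 2 ^ card U / 2"
      and TU: "T \<union> U \<subseteq> M" "T \<inter> U = {}" "N + q \<le> card U"
    for x :: 'x and k T U q
  proof (cases q)
    case 0
    \<comment> \<open>Every run through this node counts at least one query, so with budget 0 the
      success event is empty.\<close>
    then have "apsnd Suc -` {(h, m). h \<in> G \<and> m \<le> q} = {}" for G :: "('x \<Rightarrow> real) set"
      by auto
    then show ?thesis
      by simp
  next
    case (Suc q')
    have fin: "finite U"
      using TU(1) M by (meson finite_subset le_supE)
    define P where "P T L S = measure_pmf.prob (run D (F (T \<union> S)) L)
        {(h, m). h \<in> good (T \<union> S) \<and> m \<le> q'}" for T L S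
    have "apsnd Suc -` {(h, m). h \<in> G \<and> m \<le> q} = {(h, m). h \<in> G \<and> m \<le> q'}" for G :: "('x \<Rightarrow> real) set"
      using Suc by auto
    then have "(\<Sum>S\<in>Pow U. measure_pmf.prob
        (map_pmf (apsnd Suc) (run D (F (T \<union> S)) (k (F (T \<union> S) x))))
        {(h, m). h \<in> good (T \<union> S) \<and> m \<le> q}) = (\<Sum>S\<in>Pow U. P T (k (F (T \<union> S) x)) S)"
      by (simp add: P_def)
    also have "\<dots> \<le> 2 ^ card U / 2"
    proof (cases "p x \<in> U")
      case True
      \<comment> \<open>The answer depends only on whether \<open>p x\<close> is in the hidden set,
        so it is constant on each half of the split by this bit. Unseen positions and budget both
        drop by one, which preserves \<open>N + q \<le> card U\<close>.\<close>
      define U' where "U' = U - {p x}"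
      have card: "card U = Suc (card U')"
        unfolding U'_def using fin True by (rule card.remove)
      have "(\<Sum>S\<in>Pow U. P T (k (F (T \<union> S) x)) S) =
          (\<Sum>S\<in>Pow U'. P T (k (F (T \<union> S) x)) S)
          + (\<Sum>S\<in>Pow U'. P T (k (F (T \<union> insert (p x) S) x)) (insert (p x) S))"
        unfolding U'_def by (rule sum_Pow_split[OF fin True])
      also have "\<dots> = (\<Sum>S\<in>Pow U'. P T (k (g x False)) S)
          + (\<Sum>S\<in>Pow U'. P (insert (p x) T) (k (g x True)) S)"
      proof -
        have "F (T \<union> S) x = g x False" "F (T \<union> insert (p x) S) x = g x True" if "S \<in> Pow U'" for S
        proof -
          have "p x \<notin> T" "p x \<notin> S"
            using that True TU(2) by (auto simp: U'_def)
          then show "F (T \<union> S) x = g x False" "F (T \<union> insert (p x) S) x = g x True"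
            by (auto simp: F_def)
        qed
        then show ?thesis
          by (simp add: P_def)
      qed
      also have "\<dots> \<le> 2 ^ card U' / 2 + 2 ^ card U' / 2"
        unfolding P_def
      proof (rule add_mono; rule IH)
        show "T \<union> U' \<subseteq> M" "T \<inter> U' = {}" "insert (p x) T \<union> U' \<subseteq> M" "insert (p x) T \<inter> U' = {}"
          using True TU(1,2) by (auto simp: U'_def)
        show "N + q' \<le> card U'" "N + q' \<le> card U'"
          using TU(3) Suc card by simp_all
      qed
      also have "\<dots> = 2 ^ card U / 2"
        by (simp add: card)
      finally show ?thesis .
    next
      case False
      \<comment> \<open>A position outside \<open>U\<close> gets the same answer for every
        \<open>S\<close>, so nothing is revealed and \<open>U\<close> stays whole.\<close>
      then have "p x \<in> T \<union> S \<longleftrightarrow> p x \<in> T" if "S \<in> Pow U" for S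
        using that by auto
      then have "(\<Sum>S\<in>Pow U. P T (k (F (T \<union> S) x)) S) = (\<Sum>S\<in>Pow U. P T (k (g x (p x \<in> T))) S)"
        unfolding F_def by (intro sum.cong) auto
      also have "\<dots> \<le> 2 ^ card U / 2"
        unfolding P_def by (rule IH) (use TU Suc in auto)
      finally show ?thesis .
    qed
    finally show ?thesis .
  qed
  show ?thesis
    using assms(4-)
  proof (induction L arbitrary: T U q)
    case (Output h)
    have fin: "finite U"
      using Output.prems(1) M by (meson finite_subset le_supE)
    define \<phi> :: "'p set \<Rightarrow> real" where "\<phi> S = of_bool (h \<in> good (T \<union> S))" for S
    have pair: "\<phi> S + \<phi> (U - S) \<le> 1" if "S \<subseteq> U" for S
    proof -
      have "sym_diff (T \<union> S) (T \<union> (U - S)) = U"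
        using that Output.prems(2) by auto
      then have "good (T \<union> S) \<inter> good (T \<union> (U - S)) = {}"
        using that Output.prems by (intro sep) auto
      then show ?thesis
        by (auto simp: \<phi>_def)
    qed
    \<comment> \<open>Complementation in \<open>U\<close> permutes \<open>Pow U\<close>, so twice
      the sum is a sum over complementary pairs, each contributing at most 1.\<close>
    have "sum \<phi> (Pow U) = (\<Sum>S\<in>Pow U. \<phi> (U - S))"
      by (rule sum.reindex_bij_witness[where i = "\<lambda>S. U - S" and j = "\<lambda>S. U - S"])
         (auto simp: double_diff)
    then have "2 * sum \<phi> (Pow U) = (\<Sum>S\<in>Pow U. \<phi> S + \<phi> (U - S))"
      by (simp add: sum.distrib)
    also have "\<dots> \<le> (\<Sum>S\<in>Pow U. 1)"
      using pair by (intro sum_mono) auto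
    also have "\<dots> = 2 ^ card U"
      using fin by (simp add: card_Pow)
    finally show ?case
      by (simp add: \<phi>_def indicator_def of_bool_def)
  next
    case (Randomize P)
    show ?case
      unfolding run.simps bind_eq_join_pmf[symmetric]
      by (rule sum_prob_bind_pmf_le, rule Randomize.IH) (use Randomize.prems in auto)
  next
    case (Random_Example k)
    show ?case
      unfolding run.simps
      by (rule sum_prob_bind_pmf_le, rule query, rule Random_Example.IH)
         (use Random_Example.prems in auto)
  next
    case (Value_Query x k)
    show ?case
      unfolding run.simps
      by (rule query, rule Value_Query.IH) (use Value_Query.prems in auto)
  qed
qed

section \<open>Density of the middle layer\<close>

lemma central_binomial_sq_lower_bound:
  assumes "1 \<le> m"
  shows "(16::real) ^ m \<le> real (2 * m choose m) ^ 2 * (4 * real m)"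
  using assms
proof (induction m rule: nat_induct_at_least)
  case base
  show ?case by (simp add: numeral_2_eq_2)
next
  case (Suc m)
  define b where "b = real (2 * m choose m)"
  have "Suc m * (2 * Suc m choose Suc m) = 2 * (2 * m + 1) * (2 * m choose m)"
  proof -
    have "Suc m * (Suc (Suc (2 * m)) choose Suc m) = Suc (Suc (2 * m)) * (Suc (2 * m) choose m)"
      using Suc_times_binomial[of m] by blast
    moreover have "Suc m * (Suc (2 * m) choose Suc m) = Suc (2 * m) * (2 * m choose m)"
      using Suc_times_binomial[of m] by blast
    moreover have "Suc (2 * m) choose Suc m = Suc (2 * m) choose m"
      using binomial_symmetric[of m "Suc (2 * m)"] by (simp add: Suc_diff_le)
    ultimately show ?thesis
      by (simp add: algebra_simps)
  qed
  then have "real (Suc m) * real (2 * Suc m choose Suc m) = 2 * (2 * real m + 1) * b"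
    unfolding b_def by (metis (mono_tags, opaque_lifting) of_nat_1 of_nat_add of_nat_mult of_nat_numeral)
  then have eq: "real (2 * Suc m choose Suc m) = 2 * (2 * real m + 1) * b / (real m + 1)"
    by (simp add: field_simps)
  have "16 ^ Suc m \<le> 16 * (b ^ 2 * (4 * real m))"
    using Suc.IH by (simp add: b_def algebra_simps)
  \<comment> \<open>This is 4m(m+1) <= (2m+1)^2. Keeping the bound squared frees the induction from
    square roots.\<close>
  also have "\<dots> \<le> 16 * (b ^ 2 * ((2 * real m + 1) ^ 2 / (real m + 1)))"
    using Suc.hyps by (intro mult_left_mono) (auto simp: field_simps power2_eq_square)
  also have "\<dots> = (2 * (2 * real m + 1) * b / (real m + 1)) ^ 2 * (4 * (real m + 1))"
  proof -
    have "16 * (b ^ 2 * (x ^ 2 / y)) = (2 * x * b / y) ^ 2 * (4 * y)" if "y \<noteq> 0" for x y :: real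
      using that by (simp add: field_simps power2_eq_square)
    then show ?thesis by simp
  qed
  finally show ?case
    unfolding eq by (simp add: add.commute)
qed

section \<open>Dented budget functions and their distances\<close>

lemma sum_Pow_Int:
  fixes f :: "'a set \<Rightarrow> real"
  assumes "finite N" "K \<subseteq> N"
  shows "(\<Sum>A\<in>Pow N. f (A \<inter> K)) = 2 ^ card (N - K) * sum f (Pow K)"
proof -
  have "(\<Sum>A\<in>Pow N. f (A \<inter> K)) = (\<Sum>(B, C)\<in>Pow K \<times> Pow (N - K). f B)"
    by (rule sum.reindex_bij_witness[where i = "\<lambda>(B, C). B \<union> C" and j = "\<lambda>A. (A \<inter> K, A - K)"])
       (use assms in auto)
  also have "\<dots> = 2 ^ card (N - K) * sum f (Pow K)"
    using assms by (simp add: sum.cartesian_product[symmetric] card_Pow sum_distrib_left)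
  finally show ?thesis .
qed

text \<open>Intersecting with \<open>{1..2*m}\<close> lets one \<open>m\<close> serve every
  \<open>n \<ge> 2 * m\<close>. Over the common denominator, a new element below level
  \<open>m\<close> is worth 2 and a dent costs 1.\<close>

definition dented_budget :: "nat \<Rightarrow> nat set set \<Rightarrow> nat set \<Rightarrow> real" where
  "dented_budget m S A =
     (2 * real (min (card (A \<inter> {1..2*m})) m) - of_bool (A \<inter> {1..2*m} \<in> S)) / (2 * real m)"

lemma dented_budget_in_unit_interval:
  assumes "1 \<le> m" "\<And>B. B \<in> S \<Longrightarrow> card B = m"
  shows "dented_budget m S A \<in> {0..1}"
  using assms by (auto simp: dented_budget_def field_simps)

text \<open>If the trace of \<open>B\<close> is dented and strictly larger than that of
  \<open>A\<close>, the latter lies below level \<open>m\<close>, where growth gains at least 2 in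
  the numerator against a dent of 1.\<close>

lemma dented_budget_mono:
  assumes "1 \<le> m" "\<And>B. B \<in> S \<Longrightarrow> card B = m" "A \<subseteq> B"
  shows "dented_budget m S A \<le> dented_budget m S B"
proof (cases "A \<inter> {1..2*m} = B \<inter> {1..2*m}")
  case True
  then show ?thesis by (simp add: dented_budget_def)
next
  case False
  then have "card (A \<inter> {1..2*m}) < card (B \<inter> {1..2*m})"
    using assms(3) by (intro psubset_card_mono) auto
  then show ?thesis
    using assms(1) assms(2)[of "A \<inter> {1..2*m}"] assms(2)[of "B \<inter> {1..2*m}"]
    by (auto simp: dented_budget_def divide_right_mono min_def of_bool_def)
qed

text \<open>Comparable traces give equality. Otherwise a dent on the right forces a trace of size
  \<open>m\<close>, with the intersection strictly below and the union strictly above that level.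
  The budget part then has slack at least 2 in the numerator, enough for dents at both
  \<open>A\<close> and \<open>B\<close>.\<close>

lemma dented_budget_submodular:
  assumes "1 \<le> m" "\<And>B. B \<in> S \<Longrightarrow> card B = m"
  shows "dented_budget m S (A \<union> B) + dented_budget m S (A \<inter> B)
    \<le> dented_budget m S A + dented_budget m S B"
proof -
  define K where "K = {1..2*m}"
  define A' B' where "A' = A \<inter> K" and "B' = B \<inter> K"
  have fin: "finite A'" "finite B'"
    by (auto simp: A'_def B'_def K_def)
  have Int: "(A \<union> B) \<inter> K = A' \<union> B'" "A \<inter> B \<inter> K = A' \<inter> B'"
    by (auto simp: A'_def B'_def)
  define \<phi> :: "nat set \<Rightarrow> real" where "\<phi> X = 2 * real (min (card X) m) - of_bool (X \<in> S)" for X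
  have eq: "dented_budget m S X = \<phi> (X \<inter> K) / (2 * real m)" for X
    by (simp add: dented_budget_def \<phi>_def K_def)
  have "\<phi> (A' \<union> B') + \<phi> (A' \<inter> B') \<le> \<phi> A' + \<phi> B'"
  proof (cases "A' \<subseteq> B' \<or> B' \<subseteq> A'")
    case True
    then show ?thesis
      by (auto simp: Un_absorb1 Un_absorb2 Int_absorb1 Int_absorb2)
  next
    case False
    then have lt: "card (A' \<inter> B') < card A'" "card (A' \<inter> B') < card B'"
      "card A' < card (A' \<union> B')" "card B' < card (A' \<union> B')"
      using fin by (auto intro!: psubset_card_mono)
    have sum: "card A' + card B' = card (A' \<union> B') + card (A' \<inter> B')"
      using fin by (rule card_Un_Int)
    \<comment> \<open>Dents on the left only help and are dropped; on the right every set of size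
      \<open>m\<close> is treated as dented. This leaves arithmetic in four cardinalities.\<close>
    have ub: "\<phi> X \<le> 2 * real (min (card X) m)" for X
      by (simp add: \<phi>_def)
    have lb: "2 * real (min (card X) m) - of_bool (card X = m) \<le> \<phi> X" for X
      using assms(2) by (auto simp: \<phi>_def)
    have "\<phi> (A' \<union> B') + \<phi> (A' \<inter> B')
        \<le> 2 * real (min (card (A' \<union> B')) m) + 2 * real (min (card (A' \<inter> B')) m)"
      using ub add_mono by blast
    also have "\<dots> \<le> 2 * real (min (card A') m) - of_bool (card A' = m)
        + (2 * real (min (card B') m) - of_bool (card B' = m))"
      using lt sum by (auto simp: min_def of_bool_def)
    also have "\<dots> \<le> \<phi> A' + \<phi> B'"
      using lb add_mono by blast
    finally show ?thesis .
  qed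
  then show ?thesis
    unfolding eq Int A'_def[symmetric] B'_def[symmetric] add_divide_distrib[symmetric]
    by (intro divide_right_mono) auto
qed

lemma restrict_dented_budget_in_class:
  assumes "1 \<le> m" "\<And>B. B \<in> S \<Longrightarrow> card B = m"
  shows "restrict (dented_budget m S) (cube n) \<in> monotone_submodular_functions n"
  using dented_budget_in_unit_interval[OF assms] dented_budget_mono[OF assms]
    dented_budget_submodular[OF assms]
  by (auto simp: monotone_submodular_functions_def mono_on_def submodular_on_def cube_def
      simp del: atLeastAtMost_iff)

text \<open>The two functions differ by 1/(2m) at points whose trace lies in the symmetric
  difference and agree elsewhere, and each trace has probability 4^(-m).\<close>

lemma expectation_dented_budget_diff_sq:
  assumes "1 \<le> m" "2 * m \<le> n" "S \<subseteq> Pow {1..2*m}" "S' \<subseteq> Pow {1..2*m}"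
  shows "measure_pmf.expectation (pmf_of_set (cube n))
      (\<lambda>A. (restrict (dented_budget m S) (cube n) A - restrict (dented_budget m S') (cube n) A)\<^sup>2)
    = real (card (sym_diff S S')) / (4 ^ m * (4 * (real m)\<^sup>2))"
proof -
  let ?K = "{1..2*m}"
  have finc: "finite (cube n)" "cube n \<noteq> {}" "card (cube n) = 2 ^ n"
    by (auto simp: cube_def card_Pow)
  have fin: "finite (Pow ?K)" by simp
  have "(dented_budget m S A - dented_budget m S' A)\<^sup>2
      = indicator (sym_diff S S') (A \<inter> ?K) / (4 * (real m)\<^sup>2)" for A
    by (auto simp: dented_budget_def diff_divide_distrib[symmetric] power_divide power2_eq_square
        indicator_def of_bool_def)
  then have "(\<Sum>A\<in>cube n. (restrict (dented_budget m S) (cube n) A - restrict (dented_budget m S') (cube n) A)\<^sup>2)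
      = (\<Sum>A\<in>Pow {1..n}. indicator (sym_diff S S') (A \<inter> ?K) / (4 * (real m)\<^sup>2))"
    unfolding cube_def by (intro sum.cong) auto
  also have "\<dots> = 2 ^ card ({1..n} - ?K) * (\<Sum>A\<in>Pow ?K. indicator (sym_diff S S') A / (4 * (real m)\<^sup>2))"
    using assms by (intro sum_Pow_Int) auto
  also have "card ({1..n} - ?K) = n - 2 * m"
    using assms by (subst card_Diff_subset) auto
  also have "(\<Sum>A\<in>Pow ?K. indicator (sym_diff S S') A / (4 * (real m)\<^sup>2)) =
      real (card (sym_diff S S')) / (4 * (real m)\<^sup>2)"
  proof -
    have "Pow ?K \<inter> sym_diff S S' = sym_diff S S'"
      using assms by auto
    then show ?thesis
      using Indicator_Function.sum_mult_indicator[OF fin, of "\<lambda>_. 1 :: real" "sym_diff S S'"]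
      by (simp add: sum_divide_distrib[symmetric] del: sum_mult_indicator)
  qed
  finally have "(\<Sum>A\<in>cube n. (restrict (dented_budget m S) (cube n) A - restrict (dented_budget m S') (cube n) A)\<^sup>2)
      = 2 ^ (n - 2 * m) * (real (card (sym_diff S S')) / (4 * (real m)\<^sup>2))" .
  moreover have "(2::real) ^ n = 2 ^ (n - 2 * m) * 4 ^ m"
    using power_add[of "2::real" "n - 2 * m" "2 * m"] assms by (simp add: power_mult)
  ultimately show ?thesis
    using finc by (simp add: integral_pmf_of_set)
qed

section \<open>Separation of targets and the query bound\<close>

lemma l2_dist_le_imp_expectation_le:
  assumes "finite (set_pmf D)" "l2_dist D f h \<le> \<epsilon>" "l2_dist D g h \<le> \<epsilon>"
  shows "measure_pmf.expectation D (\<lambda>x. (f x - g x)\<^sup>2) \<le> 4 * \<epsilon>\<^sup>2"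
proof -
  note int = integrable_measure_pmf_finite[OF assms(1)]
  have sq: "measure_pmf.expectation D (\<lambda>x. (u x - h x)\<^sup>2) \<le> \<epsilon>\<^sup>2" if "l2_dist D u h \<le> \<epsilon>" for u
    using that unfolding l2_dist_def by (rule sqrt_le_D)
  have "measure_pmf.expectation D (\<lambda>x. (f x - g x)\<^sup>2)
      \<le> measure_pmf.expectation D (\<lambda>x. 2 * (f x - h x)\<^sup>2 + 2 * (g x - h x)\<^sup>2)"
  proof (intro integral_mono int)
    \<comment> \<open>Using (a - b)^2 <= 2a^2 + 2b^2 instead of the triangle inequality loses
      nothing here, as 2\<epsilon>^2 + 2\<epsilon>^2 = (2\<epsilon>)^2.\<close>
    fix x
    have "0 \<le> ((f x - h x) + (g x - h x))\<^sup>2" by simp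
    then show "(f x - g x)\<^sup>2 \<le> 2 * (f x - h x)\<^sup>2 + 2 * (g x - h x)\<^sup>2"
      by (simp add: power2_eq_square algebra_simps)
  qed
  also have "\<dots> = 2 * measure_pmf.expectation D (\<lambda>x. (f x - h x)\<^sup>2)
      + 2 * measure_pmf.expectation D (\<lambda>x. (g x - h x)\<^sup>2)"
    by (simp add: int)
  also have "\<dots> \<le> 4 * \<epsilon>\<^sup>2"
    using sq[OF assms(2)] sq[OF assms(3)] by simp
  finally show ?thesis .
qed

lemma query_lower_bound:
  fixes \<epsilon> :: real
  assumes m: "1 \<le> m" "2 * m \<le> n" and \<epsilon>: "64 * \<epsilon>\<^sup>2 * ((real m)\<^sup>2 * sqrt (real m)) < 1"
    and pac: "pac_learns (pmf_of_set (cube n)) (monotone_submodular_functions n) \<epsilon> L"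
    and q: "uses_at_most (pmf_of_set (cube n)) (monotone_submodular_functions n) q L"
  shows "real (2 * m choose m) < 2 * real q"
proof (rule ccontr)
  assume "\<not> ?thesis"
  then have q_le: "2 * q \<le> 2 * m choose m"
    by linarith
  define D where "D = pmf_of_set (cube n)"
  define M where "M = {A. A \<subseteq> {1..2*m} \<and> card A = m}"
  \<comment> \<open>This puts the target into the form \<open>g x (p x \<in> S)\<close> of
    \<open>sum_success_le\<close>: a value reveals only whether the trace belongs to
    \<open>S\<close>.\<close>
  define g :: "nat set \<Rightarrow> bool \<Rightarrow> real" where "g A b =
     restrict (\<lambda>A. (2 * real (min (card (A \<inter> {1..2*m})) m) - of_bool b) / (2 * real m)) (cube n) A" for A b
  define F where "F = (\<lambda>S A. g A (A \<inter> {1..2*m} \<in> S))"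
  define good where "good S = {h. l2_dist D (F S) h \<le> \<epsilon>}" for S
  have F: "F S = restrict (dented_budget m S) (cube n)" for S
    by (auto simp: F_def g_def dented_budget_def restrict_def)
  have M: "finite M" "card M = 2 * m choose m"
    using n_subsets[of "{1..2*m}" m] by (auto simp: M_def)
  \<comment> \<open>At least this many bits stay unseen after \<open>q\<close> queries; by
    \<open>q_le\<close> it is at least half of the layer.\<close>
  define N where "N = card M - q"
  have finD: "finite (set_pmf D)"
    by (simp add: D_def cube_def set_pmf_of_set[OF Pow_not_empty])
  have sep: "good S \<inter> good S' = {}" if "S \<subseteq> M" "S' \<subseteq> M" "N \<le> card (sym_diff S S')" for S S'
  proof (rule ccontr)
    assume "\<not> ?thesis"
    then obtain h where "l2_dist D (F S) h \<le> \<epsilon>" "l2_dist D (F S') h \<le> \<epsilon>"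
      by (auto simp: good_def)
    from l2_dist_le_imp_expectation_le[OF finD this]
    have "real (card (sym_diff S S')) / (4 ^ m * (4 * (real m)\<^sup>2)) \<le> 4 * \<epsilon>\<^sup>2"
      using that(1,2) m expectation_dented_budget_diff_sq[of m n S S']
      unfolding F D_def by (subst (asm) expectation_dented_budget_diff_sq) (auto simp: M_def)
    then have 1: "real (card (sym_diff S S')) \<le> 16 * \<epsilon>\<^sup>2 * (real m)\<^sup>2 * 4 ^ m"
      using m by (simp add: field_simps)
    have "(4 ^ m)\<^sup>2 \<le> (real (card M) * (2 * sqrt (real m)))\<^sup>2"
      using central_binomial_sq_lower_bound[OF m(1)] M(2)
      by (simp add: power_mult_distrib power_mult[symmetric] mult.commute[of m] power_mult)
    then have 2: "4 ^ m \<le> real (card M) * (2 * sqrt (real m))"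
      by (rule power2_le_imp_le) simp
    \<comment> \<open>The constant 64 in the assumption is the product of 2 for half of the layer,
      16 from fact \<open>1\<close> and 2 from fact \<open>2\<close>.\<close>
    have "real (card M) \<le> 2 * real N"
      using q_le M(2) by (simp add: N_def of_nat_diff)
    also have "\<dots> \<le> 32 * \<epsilon>\<^sup>2 * (real m)\<^sup>2 * 4 ^ m"
      using 1 that(3) by linarith
    also have "\<dots> \<le> 32 * \<epsilon>\<^sup>2 * (real m)\<^sup>2 * (real (card M) * (2 * sqrt (real m)))"
      using 2 by (intro mult_left_mono) auto
    also have "\<dots> = real (card M) * (64 * \<epsilon>\<^sup>2 * ((real m)\<^sup>2 * sqrt (real m)))"
      by (simp add: algebra_simps)
    also have "\<dots> < real (card M) * 1"
      using \<epsilon> M(2) by (intro mult_strict_left_mono) auto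
    finally show False by simp
  qed
  have prob: "2/3 \<le> measure_pmf.prob (run D (F S) L) {(h, k). h \<in> good S \<and> k \<le> q}" if "S \<in> Pow M" for S
  proof -
    have "F S \<in> monotone_submodular_functions n"
      unfolding F using that m by (intro restrict_dented_budget_in_class) (auto simp: M_def)
    with pac q have "2/3 \<le> measure_pmf.prob (run D (F S) L) {(h, k). h \<in> good S}"
      "\<forall>(h, k)\<in>set_pmf (run D (F S) L). k \<le> q"
      by (auto simp: pac_learns_def uses_at_most_def D_def good_def)
    \<comment> \<open>The budget is respected almost surely, so adding \<open>k \<le> q\<close> to
      the event costs no probability.\<close>
    moreover from this(2) have "measure_pmf.prob (run D (F S) L) {(h, k). h \<in> good S}
        = measure_pmf.prob (run D (F S) L) {(h, k). h \<in> good S \<and> k \<le> q}"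
      by (intro measure_pmf.finite_measure_eq_AE) (auto simp: AE_measure_pmf_iff)
    ultimately show ?thesis by simp
  qed
  have "2/3 * 2 ^ card M = (\<Sum>S\<in>Pow M. 2/3 :: real)"
    using M(1) by (simp add: card_Pow)
  also have "\<dots> \<le> (\<Sum>S\<in>Pow M. measure_pmf.prob (run D (F S) L) {(h, k). h \<in> good S \<and> k \<le> q})"
    using prob by (rule sum_mono)
  also have "\<dots> \<le> 2 ^ card M / 2"
    using sum_success_le[OF sep M(1), where T = "{}" and U = M and q = q and D = D
        and g = g and p = "\<lambda>A. A \<inter> {1..2*m}" and L = L] q_le M(2)
    by (simp add: N_def F_def)
  finally show False by simp
qed

theorem theorem6p3:
  shows "\<exists>c>0. \<exists>C>0. \<exists>\<epsilon>\<^sub>0>0. \<forall>(\<epsilon>::real) (n::nat) (L::nat set learner) (q::nat).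
    0 < \<epsilon> \<longrightarrow> \<epsilon> \<le> \<epsilon>\<^sub>0 \<longrightarrow> C * \<epsilon> powr (- (4/5)) \<le> real n \<longrightarrow>
    pac_learns (pmf_of_set (cube n)) (monotone_submodular_functions n) \<epsilon> L \<longrightarrow>
    uses_at_most (pmf_of_set (cube n)) (monotone_submodular_functions n) q L \<longrightarrow>
    2 powr (c * \<epsilon> powr (- (4/5))) \<le> real q"
proof (rule exI[of _ "1/32"], rule conjI, simp, rule exI[of _ 1], rule conjI, simp,
    rule exI[of _ "1/32"], intro conjI allI impI, simp)
  fix \<epsilon> :: real and n q :: nat and L :: "nat set learner"
  assume \<epsilon>: "0 < \<epsilon>" "\<epsilon> \<le> 1/32" and n: "1 * \<epsilon> powr (- (4/5)) \<le> real n"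
    and pac: "pac_learns (pmf_of_set (cube n)) (monotone_submodular_functions n) \<epsilon> L"
    and q: "uses_at_most (pmf_of_set (cube n)) (monotone_submodular_functions n) q L"
  define t where "t = \<epsilon> powr (- (4/5))"
  \<comment> \<open>Division by 8 makes \<open>m powr (5/2)\<close> at most \<epsilon>^(-2) / (128
    sqrt 2), small enough for the factor 64. It also gives 2m <= t/4 <= n, so C = 1
    suffices.\<close>
  define m where "m = nat \<lfloor>t / 8\<rfloor>"
  \<comment> \<open>The threshold 1/32 = 2^(-5) is chosen to give t >= 2^4, which ensures m >=
    2.\<close>
  have "(1/32) powr (- (4/5)) \<le> t"
    unfolding t_def using \<epsilon> by (intro powr_mono2') auto
  also have "(1/32) powr (- (4/5)) = ((2::real) powr (- 5)) powr (- (4/5))"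
    by (simp add: powr_minus)
  also have "\<dots> = 16"
    unfolding powr_powr by simp
  finally have t: "16 \<le> t" .
  have m_le: "real m \<le> t / 8"
    using t unfolding m_def by linarith
  have m_gt: "t / 8 < real m + 1"
    using t unfolding m_def by linarith
  have m: "2 \<le> m"
    using t m_gt by linarith
  have "(real m)\<^sup>2 * sqrt (real m) = real m powr (5/2)"
    using m powr_add[of "real m" 2 "1/2"] by (simp add: powr_half_sqrt powr_numeral)
  also have "\<dots> \<le> (t / 8) powr (5/2)"
    using m_le by (intro powr_mono2) auto
  also have "\<dots> = t powr (5/2) / 8 powr (5/2)"
    by (rule powr_divide)
  also have "t powr (5/2) = 1 / \<epsilon>\<^sup>2"
    using \<epsilon> powr_powr[of \<epsilon> "- (4/5)" "5/2"] powr_minus_divide[of \<epsilon> 2]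
    by (simp add: t_def powr_numeral del: powr_powr)
  also have "(8::real) powr (5/2) = 128 * sqrt 2"
    using powr_add[of "8::real" 2 "1/2"] real_sqrt_mult[of 4 2] by (simp add: powr_half_sqrt powr_numeral)
  finally have "64 * \<epsilon>\<^sup>2 * ((real m)\<^sup>2 * sqrt (real m)) \<le> 64 * \<epsilon>\<^sup>2 * (1 / \<epsilon>\<^sup>2 / (128 * sqrt 2))"
    by (rule mult_left_mono) simp
  also have "\<dots> = 1 / (2 * sqrt 2)"
    using \<epsilon> by (simp add: field_simps)
  also have "\<dots> < 1"
  proof -
    have "1 \<le> sqrt (2::real)" by simp
    then have "1 < 2 * sqrt (2::real)" by linarith
    then show ?thesis by simp
  qed
  finally have eps: "64 * \<epsilon>\<^sup>2 * ((real m)\<^sup>2 * sqrt (real m)) < 1" .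
  have "2 * m \<le> n"
    using m_le n t unfolding t_def[symmetric] by linarith
  with m have lower: "real (2 * m choose m) < 2 * real q"
    by (intro query_lower_bound[OF _ _ eps pac q]) auto
  \<comment> \<open>From t/8 < m + 1 follows t/32 < (m + 1)/4, and this is at most m - 1 for m >= 2.
    Hence c = 1/32; the 1 subtracted absorbs the factor 2 in \<open>lower\<close>.\<close>
  have "(2::real) powr (1/32 * t) \<le> 2 powr (real m - 1)"
    using m m_gt by (intro powr_mono) linarith+
  also have "\<dots> = 2 ^ m / 2"
    by (simp add: powr_diff powr_realpow)
  \<comment> \<open>The crude bound (2m/m)^m is enough, since only the constant in the exponent
    suffers.\<close>
  also have "(2::real) ^ m \<le> real (2 * m choose m)"
  proof -
    have "2 ^ m \<le> (2 * m choose m)"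
      using binomial_ge_n_over_k_pow_k[of m "2 * m", where 'a = real] m by simp
    then show ?thesis by simp
  qed
  also have "real (2 * m choose m) / 2 \<le> real q"
    using lower by simp
  finally show "2 powr (1/32 * \<epsilon> powr (- (4/5))) \<le> real q"
    by (simp add: t_def)
qed

end
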